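(* Let $m\ge 3$ and $1\le r\le n$ be integers. Let $\mathbf u_1,\dots,\mathbf u_r\in\mathbb R^n$ be orthonormal vectors, let $\lambda_1,\dots,\lambda_r>0$ be real numbers, and let $\mathcal S=\sum_{i=1}^r\lambda_i\,\mathbf u_i^{\circ m}$, a real symmetric tensor of order $m$ and dimension $n$. Let $\mathbb A\subseteq\{1,\dots,r\}$ be any nonempty subset. For $i\in\mathbb A$ put $\tilde c_i=\sqrt[m-2]{1/\lambda_i}$, and set $\tilde{\mathbf u}=\sum_{i\in\mathbb A}\tilde c_i\mathbf u_i$ and $l=\|\tilde{\mathbf u}\|=\sqrt{\sum_{i\in\mathbb A}\tilde c_i^2}$. Then the pair $(\lambda,\mathbf u)$ with $\lambda=\dfrac{1}{l^{m-2}}$ and $\mathbf u=\dfrac{\tilde{\mathbf u}}{l}$ is a Z-eigenpair of $\mathcal S$.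
   Context: For a vector $\mathbf a\in\mathbb R^n$, $\mathbf a^{\circ m}$ denotes the order-$m$ symmetric tensor with entries $(\mathbf a^{\circ m})_{i_1,\dots,i_m}=a_{i_1}\cdots a_{i_m}$. For a real symmetric tensor $\mathcal S=(s_{i_1,\dots,i_m})_{1\le i_1,\dots,i_m\le n}$ (entries invariant under permutation of the indices) and a vector $\mathbf u$, $\mathcal S\mathbf u^{m-1}$ is the vector with $j$th entry $\sum_{i_2,\dots,i_m=1}^n s_{j,i_2,\dots,i_m}u_{i_2}\cdots u_{i_m}$. A pair $(\lambda,\mathbf u)$ with $\mathbf u\in\mathbb R^n$, $\mathbf u^{\mathrm T}\mathbf u=1$, is a Z-eigenpair of $\mathcal S$ if $\mathcal S\mathbf u^{m-1}=\lambda\mathbf u$. The root $\sqrt[m-2]{1/\lambda_i}$ is the positive real root. *)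

theory Defs
  imports "HOL-Analysis.Analysis"
begin

(* A tensor of order m and dimension CARD('n) is given by its entries: the multi-index
   (i_1, ..., i_m) is the list [i_1, ..., i_m]. Lists of any other length carry the entry 0,
   so that equality of tensors of order m is equality of functions. *)
type_synonym 'n tensor = "'n list \<Rightarrow> real"

definition is_tensor :: "nat \<Rightarrow> 'n tensor \<Rightarrow> bool" where
  "is_tensor m S \<longleftrightarrow> (\<forall>js. length js \<noteq> m \<longrightarrow> S js = 0)"

definition symmetric_tensor :: "nat \<Rightarrow> 'n tensor \<Rightarrow> bool" where
  "symmetric_tensor m S \<longleftrightarrow> is_tensor m S \<and>
     (\<forall>js p. length js = m \<longrightarrow> p permutes {..<m} \<longrightarrow> S (permute_list p js) = S js)"

definition tensor_power :: "nat \<Rightarrow> real ^ 'n \<Rightarrow> 'n tensor" where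
  "tensor_power m a = (\<lambda>js. if length js = m then (\<Prod>i\<leftarrow>js. a $ i) else 0)"

(* The vector S u^(m-1). The index set of the sum is finite, since 'n is a finite type. *)
definition tensor_apply :: "nat \<Rightarrow> 'n tensor \<Rightarrow> real ^ 'n \<Rightarrow> real ^ 'n" where
  "tensor_apply m S u = (\<chi> j. \<Sum>js | length js = m - 1. S (j # js) * (\<Prod>i\<leftarrow>js. u $ i))"

definition Z_eigenpair :: "nat \<Rightarrow> 'n tensor \<Rightarrow> real \<Rightarrow> real ^ 'n \<Rightarrow> bool" where
  "Z_eigenpair m S \<mu> u \<longleftrightarrow>
     symmetric_tensor m S \<and> u \<bullet> u = 1 \<and> tensor_apply m S u = \<mu> *\<^sub>R u"

end

theory Submission
  imports Defs
begin

text \<open>A rank-one tensor contracts to a multiple of its own vector: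
  \<open>tensor_apply_tensor_power\<close> gives (a \<bullet> v)^(m-1) a, because a sum over
  multi-indices of products factors into a power of a single sum
  (\<open>sum_prod_list_lists_length\<close>). By linearity (\<open>tensor_apply_sum\<close>),
  \<open>S\<close> sends v to the sum of lam_i (u_i \<bullet> v)^(m-1) u_i. Orthonormality makes u_i
  \<bullet> ut equal to c_i on \<open>A\<close> and 0 elsewhere, and c_i is chosen so that lam_i
  c_i^(m-1) = c_i. Hence \<open>ut\<close> is a fixed point of the contraction, and homogeneity of
  degree m-1 turns this into the eigenvalue 1/l^(m-2) for the unit vector ut/l.\<close>

lemma sum_prod_list_lists_length:
  fixes f :: "'a::finite \<Rightarrow> 'b::comm_semiring_1"
  shows "(\<Sum>xs | length xs = k. \<Prod>x\<leftarrow>xs. f x) = (\<Sum>x\<in>UNIV. f x) ^ k"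
proof (induction k)
  case 0
  then show ?case by simp
next
  case (Suc k)
  \<comment> \<open>Splitting off the head makes the index set a product, so that distributivity
    applies.\<close>
  have img: "{xs :: 'a list. length xs = Suc k} = (\<lambda>(x, xs). x # xs) ` (UNIV \<times> {xs. length xs = k})"
    by (auto simp: length_Suc_conv image_iff)
  have inj: "inj_on (\<lambda>(x, xs). x # xs) (UNIV \<times> {xs :: 'a list. length xs = k})"
    by (auto simp: inj_on_def)
  have "(\<Sum>xs | length xs = Suc k. \<Prod>x\<leftarrow>xs. f x)
      = (\<Sum>(x, xs)\<in>UNIV \<times> {xs. length xs = k}. f x * (\<Prod>x\<leftarrow>xs. f x))"
    unfolding img by (subst sum.reindex[OF inj]) (simp add: case_prod_unfold)
  also have "\<dots> = (\<Sum>x\<in>UNIV. f x) * (\<Sum>xs | length xs = k. \<Prod>x\<leftarrow>xs. f x)"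
    by (simp add: sum_product sum.cartesian_product)
  finally show ?case
    using Suc.IH by simp
qed

lemma prod_list_mult:
  fixes f g :: "'a \<Rightarrow> 'b::comm_monoid_mult"
  shows "(\<Prod>x\<leftarrow>xs. f x * g x) = (\<Prod>x\<leftarrow>xs. f x) * (\<Prod>x\<leftarrow>xs. g x)"
  by (induction xs) (simp_all add: mult_ac)

text \<open>Entry j of the contraction is a_j times a sum of products of a_i v_i over lists of
  length m-1. The bound on \<open>m\<close> ensures that \<open>j # js\<close> has length exactly
  \<open>m\<close>, where \<open>tensor_power\<close> takes its product value.\<close>

lemma tensor_apply_tensor_power:
  assumes "m \<ge> 1"
  shows "tensor_apply m (tensor_power m a) v = (a \<bullet> v) ^ (m - 1) *\<^sub>R a"
proof (rule vec_eq_iff[THEN iffD2, rule_format])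
  fix j
  have "tensor_apply m (tensor_power m a) v $ j
      = (\<Sum>js | length js = m - 1. a $ j * (\<Prod>i\<leftarrow>js. a $ i * v $ i))"
    using assms by (auto simp: tensor_apply_def tensor_power_def prod_list_mult intro!: sum.cong)
  also have "\<dots> = a $ j * (a \<bullet> v) ^ (m - 1)"
    by (simp add: sum_distrib_left[symmetric] sum_prod_list_lists_length inner_vec_def)
  finally show "tensor_apply m (tensor_power m a) v $ j = ((a \<bullet> v) ^ (m - 1) *\<^sub>R a) $ j"
    by simp
qed

lemma tensor_apply_sum:
  "tensor_apply m (\<lambda>js. \<Sum>i\<in>I. w i * T i js) v = (\<Sum>i\<in>I. w i *\<^sub>R tensor_apply m (T i) v)"
  by (simp add: vec_eq_iff tensor_apply_def sum_distrib_left sum_distrib_right mult.assoc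
      sum.swap[where B = I])

text \<open>An entry is a commutative product, so it depends only on the multiset of indices, which
  a permutation preserves.\<close>

lemma symmetric_tensor_tensor_power: "symmetric_tensor m (tensor_power m a)"
proof -
  have "(\<Prod>i\<leftarrow>permute_list p js. a $ i) = (\<Prod>i\<leftarrow>js. a $ i)"
    if "p permutes {..<length js}" for p js
    using that by (metis mset_map mset_permute_list prod_mset_prod_list)
  then show ?thesis
    by (auto simp: symmetric_tensor_def is_tensor_def tensor_power_def)
qed

lemma symmetric_tensor_sum:
  assumes "\<And>i. i \<in> I \<Longrightarrow> symmetric_tensor m (T i)"
  shows "symmetric_tensor m (\<lambda>js. \<Sum>i\<in>I. w i * T i js)"
  using assms by (auto simp: symmetric_tensor_def is_tensor_def)

theorem lemma2:
  fixes m r :: nat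
    and u :: "nat \<Rightarrow> real ^ 'n"
    and lam c :: "nat \<Rightarrow> real"
    and S :: "'n tensor"
    and A :: "nat set"
    and ut :: "real ^ 'n"
    and l :: real
  assumes "m \<ge> 3"
    and "1 \<le> r" and "r \<le> CARD('n)"
    and orthonormal: "\<And>i j. i \<in> {1..r} \<Longrightarrow> j \<in> {1..r} \<Longrightarrow> u i \<bullet> u j = (if i = j then 1 else 0)"
    and lam_pos: "\<And>i. i \<in> {1..r} \<Longrightarrow> lam i > 0"
    and S: "S = (\<lambda>js. \<Sum>i=1..r. lam i * tensor_power m (u i) js)"
    and "A \<subseteq> {1..r}" and "A \<noteq> {}"
    and c: "\<And>i. i \<in> A \<Longrightarrow> c i = root (m - 2) (1 / lam i)"
    and ut: "ut = (\<Sum>i\<in>A. c i *\<^sub>R u i)"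
    and l: "l = norm ut"
  shows "l = sqrt (\<Sum>i\<in>A. (c i)\<^sup>2) \<and> Z_eigenpair m S (1 / l ^ (m - 2)) (ut /\<^sub>R l)"
proof -
  have [simp]: "finite A"
    using \<open>A \<subseteq> {1..r}\<close> finite_subset by blast
  \<comment> \<open>Since m \<ge> 3, the exponent m-2 is positive and the root of the positive
    number 1/lam_i is a genuine inverse of the power.\<close>
  have c_pos: "c i > 0" and lam_c: "lam i * c i ^ (m - 2) = 1" if "i \<in> A" for i
  proof -
    have "lam i > 0" using that \<open>A \<subseteq> {1..r}\<close> lam_pos by blast
    then show "c i > 0" "lam i * c i ^ (m - 2) = 1"
      using c[OF that] \<open>m \<ge> 3\<close> by (simp_all add: real_root_pow_pos2)
  qed
  have inner_ut: "u i \<bullet> ut = (if i \<in> A then c i else 0)" if "i \<in> {1..r}" for i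
  proof -
    have "u i \<bullet> ut = (\<Sum>j\<in>A. c j * (u i \<bullet> u j))"
      by (simp add: ut inner_sum_right)
    also have "\<dots> = (\<Sum>j\<in>A. if i = j then c j else 0)"
      using that \<open>A \<subseteq> {1..r}\<close> orthonormal by (intro sum.cong) auto
    finally show ?thesis by simp
  qed
  \<comment> \<open>Only the left factor is expanded; the right one stays folded so that
    \<open>inner_ut\<close> evaluates each term.\<close>
  have "ut \<bullet> ut = (\<Sum>i\<in>A. c i * (u i \<bullet> ut))"
    by (subst (1) ut) (simp add: inner_sum_left)
  also have "\<dots> = (\<Sum>i\<in>A. (c i)\<^sup>2)"
    using inner_ut \<open>A \<subseteq> {1..r}\<close> by (intro sum.cong) (auto simp: power2_eq_square)
  finally have ut_ut: "ut \<bullet> ut = (\<Sum>i\<in>A. (c i)\<^sup>2)" .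
  moreover have "\<dots> > 0"
    using \<open>A \<noteq> {}\<close> c_pos by (intro sum_pos) (auto simp: less_imp_neq[THEN not_sym])
  ultimately have l_sqrt: "l = sqrt (\<Sum>i\<in>A. (c i)\<^sup>2)" and l_pos: "l > 0"
    by (simp_all add: l norm_eq_sqrt_inner)
  define v where "v = ut /\<^sub>R l"
  have "v \<bullet> v = 1"
    using l_pos by (simp add: v_def l dot_square_norm power2_eq_square)
  moreover have "symmetric_tensor m S"
    unfolding S by (intro symmetric_tensor_sum symmetric_tensor_tensor_power)
  moreover have "tensor_apply m S v = (1 / l ^ (m - 2)) *\<^sub>R v"
  proof -
    \<comment> \<open>Stated for \<open>m - Suc 0\<close>, the simplifier's normal form of
      \<open>m - 1\<close>. It splits one factor off the power and shows that the exponent is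
      nonzero.\<close>
    have m1: "m - Suc 0 = Suc (m - 2)" using \<open>m \<ge> 3\<close> by simp
    have "tensor_apply m S v = (\<Sum>i=1..r. (lam i * (u i \<bullet> v) ^ (m - 1)) *\<^sub>R u i)"
      using \<open>m \<ge> 3\<close> by (simp add: S tensor_apply_sum tensor_apply_tensor_power)
    \<comment> \<open>Outside \<open>A\<close> the inner product with v is 0, and so is its power,
      the exponent being positive.\<close>
    also have "\<dots> = (\<Sum>i\<in>A. (lam i * (u i \<bullet> v) ^ (m - 1)) *\<^sub>R u i)"
      using \<open>A \<subseteq> {1..r}\<close> inner_ut m1 by (intro sum.mono_neutral_right) (auto simp: v_def)
    also have "\<dots> = (\<Sum>i\<in>A. (1 / l ^ (m - 1)) *\<^sub>R c i *\<^sub>R u i)"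
    proof (intro sum.cong refl)
      fix i assume i: "i \<in> A"
      have "u i \<bullet> v = c i / l"
        using inner_ut i \<open>A \<subseteq> {1..r}\<close> by (auto simp: v_def field_simps)
      \<comment> \<open>Grouped so that lam_i c_i^(m-2) = 1 cancels and a single c_i
        remains.\<close>
      then have "lam i * (u i \<bullet> v) ^ (m - 1) = lam i * c i ^ (m - 2) * c i / l ^ (m - 1)"
        by (simp add: m1 power_divide)
      then show "(lam i * (u i \<bullet> v) ^ (m - 1)) *\<^sub>R u i = (1 / l ^ (m - 1)) *\<^sub>R c i *\<^sub>R u i"
        using lam_c[OF i] by simp
    qed
    also have "\<dots> = (1 / l ^ (m - 1)) *\<^sub>R ut"
      by (simp only: ut scaleR_sum_right)
    \<comment> \<open>One factor 1/l is absorbed in normalizing \<open>ut\<close> to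
      \<open>v\<close>.\<close>
    also have "\<dots> = (1 / l ^ (m - 2)) *\<^sub>R v"
      by (simp add: v_def m1 divide_inverse)
    finally show ?thesis .
  qed
  ultimately show ?thesis
    using l_sqrt by (simp add: Z_eigenpair_def v_def)
qed

end
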